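(* Let $(R_k)_{k\in S}$ be a family of local commutative rings indexed by a set $S$, with $\mathfrak m_k$ the maximal ideal of $R_k$. Let $R=\prod_{k\in S}R_k$, let $I=\bigoplus_{k\in S}R_k$, and let $T$ be the multiplicative subset of $R$ consisting of all $r=(r_k)\in R$ such that $\Omega(r)=\{k\in S: r_k\notin\mathfrak m_k\}$ is cofinite in $S$. Then $R/I$ is canonically isomorphic to the localization $T^{-1}R$; that is, the assignment $a+I\mapsto a/1$ is a well-defined ring isomorphism $R/I\to T^{-1}R$.
   Context: All rings are commutative with identity; a local ring is a ring with exactly one maximal ideal (no Noetherian hypothesis). A subset of $S$ is cofinite if its complement in $S$ is finite. The direct sum ideal $\bigoplus_{k\in S}R_k$ is the ideal of $R$ of all $(r_k)$ with $r_k=0$ for all but finitely many $k$. *)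

theory Defs
  imports "HOL-Algebra.Algebra"
begin

section \<open>Local rings\<close>

text \<open>No Noetherian hypothesis is made. Uniqueness of the maximal ideal includes its existence, so
  the zero ring is not local.\<close>

locale local_cring = cring +
  assumes unique_maximalideal: "\<exists>!M. maximalideal M R"


section \<open>Product of a family of rings\<close>

text \<open>The ring counterpart of \<^const>\<open>product_group\<close>: elements are extensional functions, so that
  equality in the product is equality of all components with index in \<open>S\<close>.\<close>

definition product_ring :: "'k set \<Rightarrow> ('k \<Rightarrow> ('a, 'c) ring_scheme) \<Rightarrow> ('k \<Rightarrow> 'a) ring" where
  "product_ring S R =
    \<lparr>carrier = (\<Pi>\<^sub>E k\<in>S. carrier (R k)),
     monoid.mult = (\<lambda>x y. \<lambda>k\<in>S. x k \<otimes>\<^bsub>R k\<^esub> y k),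
     monoid.one = (\<lambda>k\<in>S. \<one>\<^bsub>R k\<^esub>),
     ring.zero = (\<lambda>k\<in>S. \<zero>\<^bsub>R k\<^esub>),
     ring.add = (\<lambda>x y. \<lambda>k\<in>S. x k \<oplus>\<^bsub>R k\<^esub> y k)\<rparr>"

definition direct_sum_ideal :: "'k set \<Rightarrow> ('k \<Rightarrow> ('a, 'c) ring_scheme) \<Rightarrow> ('k \<Rightarrow> 'a) set" where
  "direct_sum_ideal S R =
    {r \<in> carrier (product_ring S R). finite {k \<in> S. r k \<noteq> \<zero>\<^bsub>R k\<^esub>}}"


lemma product_ring_simps:
  "carrier (product_ring S R) = (\<Pi>\<^sub>E k\<in>S. carrier (R k))"
  "\<one>\<^bsub>product_ring S R\<^esub> = (\<lambda>k\<in>S. \<one>\<^bsub>R k\<^esub>)"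
  "\<zero>\<^bsub>product_ring S R\<^esub> = (\<lambda>k\<in>S. \<zero>\<^bsub>R k\<^esub>)"
  "x \<otimes>\<^bsub>product_ring S R\<^esub> y = (\<lambda>k\<in>S. x k \<otimes>\<^bsub>R k\<^esub> y k)"
  "x \<oplus>\<^bsub>product_ring S R\<^esub> y = (\<lambda>k\<in>S. x k \<oplus>\<^bsub>R k\<^esub> y k)"
  by (simp_all add: product_ring_def)

lemma cring_product_ring:
  assumes cring: "\<And>k. k \<in> S \<Longrightarrow> cring (R k)"
  shows "cring (product_ring S R)"
proof -
  have mono: "comm_monoid (R k)" "abelian_group (R k)" "ring (R k)" if "k \<in> S" for k
    using cring[OF that] by (auto simp: cring_def ring_def)
  note closed = monoid.m_closed[OF comm_monoid.axioms(1)[OF mono(1)]]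
    monoid.one_closed[OF comm_monoid.axioms(1)[OF mono(1)]]
    abelian_groupE(1,2)[OF mono(2)] abelian_group.a_inv_closed[OF mono(2)]
  note laws = comm_monoid.m_ac[OF mono(1)] monoid.l_one[OF comm_monoid.axioms(1)[OF mono(1)]]
    monoid.r_one[OF comm_monoid.axioms(1)[OF mono(1)]] abelian_groupE(3,4,5)[OF mono(2)]
    abelian_monoid.a_lcomm[OF abelian_group.axioms(1)[OF mono(2)]]
    abelian_monoid.r_zero[OF abelian_group.axioms(1)[OF mono(2)]] abelian_group.r_neg[OF mono(2)]
    ring.ring_simprules(13,23)[OF mono(3)]
  show ?thesis
  proof (intro cringI abelian_groupI comm_monoidI)
    fix x assume x: "x \<in> carrier (product_ring S R)"
    show "\<exists>y\<in>carrier (product_ring S R). y \<oplus>\<^bsub>product_ring S R\<^esub> x = \<zero>\<^bsub>product_ring S R\<^esub>"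
      by (rule bexI[where x = "\<lambda>k\<in>S. \<ominus>\<^bsub>R k\<^esub> x k"])
        (use x in \<open>auto simp: product_ring_simps PiE_iff closed laws intro!: restrict_ext\<close>)
  next
    fix x assume "x \<in> carrier (product_ring S R)"
    then show "\<zero>\<^bsub>product_ring S R\<^esub> \<oplus>\<^bsub>product_ring S R\<^esub> x = x" "\<one>\<^bsub>product_ring S R\<^esub> \<otimes>\<^bsub>product_ring S R\<^esub> x = x"
      by (auto simp: product_ring_simps PiE_iff extensional_def fun_eq_iff restrict_def closed laws)
  qed (auto simp: product_ring_simps PiE_iff closed laws intro!: restrict_ext)
qed

section \<open>Cofinite sets and the support modulo the maximal ideals\<close>

definition cofinite_in :: "'k set \<Rightarrow> 'k set \<Rightarrow> bool" where
  "cofinite_in S A \<longleftrightarrow> A \<subseteq> S \<and> finite (S - A)"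

definition Omega :: "'k set \<Rightarrow> ('k \<Rightarrow> 'a set) \<Rightarrow> ('k \<Rightarrow> 'a) \<Rightarrow> 'k set" where
  "Omega S \<mm> r = {k \<in> S. r k \<notin> \<mm> k}"


section \<open>Localization at a multiplicative subset\<close>

text \<open>A multiplicative subset of \<open>R\<close> is a \<^const>\<open>submonoid\<close> of its multiplicative monoid; zero
  divisors are allowed, hence the extra factor \<open>u\<close>.\<close>

definition frac_rel :: "('a, 'c) ring_scheme \<Rightarrow> 'a set \<Rightarrow> (('a \<times> 'a) \<times> ('a \<times> 'a)) set" where
  "frac_rel R T =
    {((a, s), (b, t)). a \<in> carrier R \<and> s \<in> T \<and> b \<in> carrier R \<and> t \<in> T \<and>
      (\<exists>u\<in>T. u \<otimes>\<^bsub>R\<^esub> (t \<otimes>\<^bsub>R\<^esub> a \<ominus>\<^bsub>R\<^esub> s \<otimes>\<^bsub>R\<^esub> b) = \<zero>\<^bsub>R\<^esub>)}"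

text \<open>The fraction \<open>a/s\<close>.\<close>

definition fraction :: "('a, 'c) ring_scheme \<Rightarrow> 'a set \<Rightarrow> 'a \<Rightarrow> 'a \<Rightarrow> ('a \<times> 'a) set" where
  "fraction R T a s = frac_rel R T `` {(a, s)}"

text \<open>As for \<^const>\<open>rcoset_mult\<close>, the operations on classes are unions over all representatives;
  all members of such a union coincide, see \<open>localization_mult\<close> and \<open>localization_add\<close> below.\<close>

definition localization :: "('a, 'c) ring_scheme \<Rightarrow> 'a set \<Rightarrow> ('a \<times> 'a) set ring" where
  "localization R T =
    \<lparr>carrier = (carrier R \<times> T) // frac_rel R T,
     monoid.mult = (\<lambda>A B. \<Union>(a, s)\<in>A. \<Union>(b, t)\<in>B. fraction R T (a \<otimes>\<^bsub>R\<^esub> b) (s \<otimes>\<^bsub>R\<^esub> t)),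
     monoid.one = fraction R T \<one>\<^bsub>R\<^esub> \<one>\<^bsub>R\<^esub>,
     ring.zero = fraction R T \<zero>\<^bsub>R\<^esub> \<one>\<^bsub>R\<^esub>,
     ring.add = (\<lambda>A B. \<Union>(a, s)\<in>A. \<Union>(b, t)\<in>B.
       fraction R T (t \<otimes>\<^bsub>R\<^esub> a \<oplus>\<^bsub>R\<^esub> s \<otimes>\<^bsub>R\<^esub> b) (s \<otimes>\<^bsub>R\<^esub> t))\<rparr>"

lemma UN_pairs_const:
  assumes "(a0, s0) \<in> A" "(b0, t0) \<in> B"
    and "\<And>a s b t. (a, s) \<in> A \<Longrightarrow> (b, t) \<in> B \<Longrightarrow> f a s b t = c"
  shows "(\<Union>(a, s)\<in>A. \<Union>(b, t)\<in>B. f a s b t) = c"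
proof -
  have "(\<Union>(a, s)\<in>A. \<Union>(b, t)\<in>B. f a s b t) = (\<Union>p\<in>A. \<Union>q\<in>B. c)"
    using assms(3) by (intro SUP_cong) auto
  also have "\<dots> = c"
    using assms(1,2) by auto
  finally show ?thesis .
qed

locale cring_mult_subset = cring R + submonoid T R for R (structure) and T
begin

lemma T_carrier: "s \<in> T \<Longrightarrow> s \<in> carrier R"
  using subset by blast

lemma frac_rel_iff:
  "((a, s), (b, t)) \<in> frac_rel R T \<longleftrightarrow>
    a \<in> carrier R \<and> s \<in> T \<and> b \<in> carrier R \<and> t \<in> T \<and> (\<exists>u\<in>T. u \<otimes> (t \<otimes> a) = u \<otimes> (s \<otimes> b))"
proof -
  have "u \<otimes> (t \<otimes> a \<ominus> s \<otimes> b) = \<zero> \<longleftrightarrow> u \<otimes> (t \<otimes> a) = u \<otimes> (s \<otimes> b)"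
    if "a \<in> carrier R" "s \<in> T" "b \<in> carrier R" "t \<in> T" "u \<in> T" for u
  proof -
    have c: "u \<in> carrier R" "t \<otimes> a \<in> carrier R" "s \<otimes> b \<in> carrier R"
      using that T_carrier by auto
    have "u \<otimes> (t \<otimes> a \<ominus> s \<otimes> b) = u \<otimes> (t \<otimes> a) \<ominus> u \<otimes> (s \<otimes> b)"
      using c by (simp add: a_minus_def r_distr r_minus)
    then show ?thesis using c by simp
  qed
  then show ?thesis by (auto simp: frac_rel_def)
qed

lemma frac_rel_equiv: "equiv (carrier R \<times> T) (frac_rel R T)"
proof (rule equivI)
  show "frac_rel R T \<subseteq> (carrier R \<times> T) \<times> (carrier R \<times> T)"
    by (auto simp: frac_rel_def)
  show "refl_on (carrier R \<times> T) (frac_rel R T)"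
    using one_closed by (auto simp: refl_on_def frac_rel_iff)
  show "sym (frac_rel R T)"
    by (auto simp: sym_def frac_rel_iff) metis
  show "trans (frac_rel R T)"
  proof (rule transI, clarify)
    fix a s b t c w
    assume "((a, s), (b, t)) \<in> frac_rel R T" "((b, t), (c, w)) \<in> frac_rel R T"
    then obtain u v where T: "s \<in> T" "t \<in> T" "w \<in> T" "u \<in> T" "v \<in> T"
      and abc: "a \<in> carrier R" "b \<in> carrier R" "c \<in> carrier R"
      and u: "u \<otimes> (t \<otimes> a) = u \<otimes> (s \<otimes> b)" and v: "v \<otimes> (w \<otimes> b) = v \<otimes> (t \<otimes> c)"
      by (auto simp: frac_rel_iff)
    note car = T[THEN T_carrier] abc
    have "(u \<otimes> v \<otimes> t) \<otimes> (w \<otimes> a) = (v \<otimes> w) \<otimes> (u \<otimes> (t \<otimes> a))"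
      using car by (simp add: m_ac)
    also have "\<dots> = (v \<otimes> w) \<otimes> (u \<otimes> (s \<otimes> b))"
      by (simp only: u)
    also have "\<dots> = (u \<otimes> s) \<otimes> (v \<otimes> (w \<otimes> b))"
      using car by (simp add: m_ac)
    also have "\<dots> = (u \<otimes> s) \<otimes> (v \<otimes> (t \<otimes> c))"
      by (simp only: v)
    also have "\<dots> = (u \<otimes> v \<otimes> t) \<otimes> (s \<otimes> c)"
      using car by (simp add: m_ac)
    finally show "((a, s), (c, w)) \<in> frac_rel R T"
      using T abc by (auto simp: frac_rel_iff)
  qed
qed

lemma fraction_eq_iff:
  assumes "a \<in> carrier R" "s \<in> T" "b \<in> carrier R" "t \<in> T"
  shows "fraction R T a s = fraction R T b t \<longleftrightarrow> (\<exists>u\<in>T. u \<otimes> (t \<otimes> a) = u \<otimes> (s \<otimes> b))"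
  unfolding fraction_def using assms
  by (subst eq_equiv_class_iff[OF frac_rel_equiv]) (auto simp: frac_rel_iff)

lemma localization_carrier: "carrier (localization R T) = {fraction R T a s |a s. a \<in> carrier R \<and> s \<in> T}"
  by (auto simp: localization_def quotient_def fraction_def)

lemma mem_fraction:
  assumes "a \<in> carrier R" "s \<in> T"
  shows "(a, s) \<in> fraction R T a s"
  unfolding fraction_def using equiv_class_self[OF frac_rel_equiv] assms by auto

lemma mem_fractionD:
  assumes "(b, t) \<in> fraction R T a s"
  shows "b \<in> carrier R" "t \<in> T" "\<exists>u\<in>T. u \<otimes> (t \<otimes> a) = u \<otimes> (s \<otimes> b)"
  using assms by (auto simp: fraction_def frac_rel_iff)

lemma localization_mult:
  assumes "a \<in> carrier R" "s \<in> T" "b \<in> carrier R" "t \<in> T"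
  shows "fraction R T a s \<otimes>\<^bsub>localization R T\<^esub> fraction R T b t = fraction R T (a \<otimes> b) (s \<otimes> t)"
proof -
  have *: "fraction R T (a' \<otimes> b') (s' \<otimes> t') = fraction R T (a \<otimes> b) (s \<otimes> t)"
    if mem: "(a', s') \<in> fraction R T a s" "(b', t') \<in> fraction R T b t" for a' s' b' t'
  proof -
    from mem_fractionD[OF mem(1)] mem_fractionD[OF mem(2)] obtain u v
      where T: "s' \<in> T" "t' \<in> T" "u \<in> T" "v \<in> T" and ab: "a' \<in> carrier R" "b' \<in> carrier R"
      and u: "u \<otimes> (s' \<otimes> a) = u \<otimes> (s \<otimes> a')" and v: "v \<otimes> (t' \<otimes> b) = v \<otimes> (t \<otimes> b')"
      by auto
    note car = T[THEN T_carrier] ab assms(1,3) assms(2,4)[THEN T_carrier]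
    have "(u \<otimes> v) \<otimes> ((s \<otimes> t) \<otimes> (a' \<otimes> b')) = (u \<otimes> (s \<otimes> a')) \<otimes> (v \<otimes> (t \<otimes> b'))"
      using car by (simp add: m_ac)
    also have "\<dots> = (u \<otimes> (s' \<otimes> a)) \<otimes> (v \<otimes> (t' \<otimes> b))"
      by (simp add: u v)
    also have "\<dots> = (u \<otimes> v) \<otimes> ((s' \<otimes> t') \<otimes> (a \<otimes> b))"
      using car by (simp add: m_ac)
    finally show ?thesis
      using T ab assms by (subst fraction_eq_iff) auto
  qed
  show ?thesis
    by (simp add: localization_def UN_pairs_const[OF mem_fraction[OF assms(1,2)] mem_fraction[OF assms(3,4)] *])
qed

lemma localization_add:
  assumes "a \<in> carrier R" "s \<in> T" "b \<in> carrier R" "t \<in> T"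
  shows "fraction R T a s \<oplus>\<^bsub>localization R T\<^esub> fraction R T b t = fraction R T (t \<otimes> a \<oplus> s \<otimes> b) (s \<otimes> t)"
proof -
  have *: "fraction R T (t' \<otimes> a' \<oplus> s' \<otimes> b') (s' \<otimes> t') = fraction R T (t \<otimes> a \<oplus> s \<otimes> b) (s \<otimes> t)"
    if mem: "(a', s') \<in> fraction R T a s" "(b', t') \<in> fraction R T b t" for a' s' b' t'
  proof -
    from mem_fractionD[OF mem(1)] mem_fractionD[OF mem(2)] obtain u v
      where T: "s' \<in> T" "t' \<in> T" "u \<in> T" "v \<in> T" and ab: "a' \<in> carrier R" "b' \<in> carrier R"
      and u: "u \<otimes> (s' \<otimes> a) = u \<otimes> (s \<otimes> a')" and v: "v \<otimes> (t' \<otimes> b) = v \<otimes> (t \<otimes> b')"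
      by auto
    note car = T[THEN T_carrier] ab assms(1,3) assms(2,4)[THEN T_carrier]
    have "(u \<otimes> v) \<otimes> ((s \<otimes> t) \<otimes> (t' \<otimes> a' \<oplus> s' \<otimes> b'))
        = (v \<otimes> t \<otimes> t') \<otimes> (u \<otimes> (s \<otimes> a')) \<oplus> (u \<otimes> s \<otimes> s') \<otimes> (v \<otimes> (t \<otimes> b'))"
      using car by (simp add: r_distr m_ac)
    also have "\<dots> = (v \<otimes> t \<otimes> t') \<otimes> (u \<otimes> (s' \<otimes> a)) \<oplus> (u \<otimes> s \<otimes> s') \<otimes> (v \<otimes> (t' \<otimes> b))"
      by (simp add: u v)
    also have "\<dots> = (u \<otimes> v) \<otimes> ((s' \<otimes> t') \<otimes> (t \<otimes> a \<oplus> s \<otimes> b))"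
      using car by (simp add: r_distr m_ac)
    finally show ?thesis
      using T ab assms T_carrier by (subst fraction_eq_iff) auto
  qed
  show ?thesis
    by (simp add: localization_def UN_pairs_const[OF mem_fraction[OF assms(1,2)] mem_fraction[OF assms(3,4)] *])
qed

lemma localization_one: "\<one>\<^bsub>localization R T\<^esub> = fraction R T \<one> \<one>"
  and localization_zero: "\<zero>\<^bsub>localization R T\<^esub> = fraction R T \<zero> \<one>"
  by (simp_all add: localization_def)

lemma cring_localization: "cring (localization R T)"
proof -
  let ?L = "localization R T"
  note ops = localization_mult localization_add localization_one localization_zero T_carrier
  have eq: "fraction R T a s = fraction R T b t"
    if "a \<in> carrier R" "s \<in> T" "b \<in> carrier R" "t \<in> T" "t \<otimes> a = s \<otimes> b" for a s b t
    using that one_closed by (subst fraction_eq_iff) auto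
  have closed: "fraction R T a s \<in> carrier ?L" if "a \<in> carrier R" "s \<in> T" for a s
    using that by (auto simp: localization_carrier)
  have rep: "\<exists>a s. x = fraction R T a s \<and> a \<in> carrier R \<and> s \<in> T" if "x \<in> carrier ?L" for x
    using that by (auto simp: localization_carrier)
  show ?thesis
  proof (intro cringI abelian_groupI comm_monoidI)
    show "\<zero>\<^bsub>?L\<^esub> \<in> carrier ?L" "\<one>\<^bsub>?L\<^esub> \<in> carrier ?L"
      by (simp_all add: ops closed)
  next
    fix x assume "x \<in> carrier ?L"
    then obtain a s where x: "x = fraction R T a s" "a \<in> carrier R" "s \<in> T"
      using rep by blast
    show "\<zero>\<^bsub>?L\<^esub> \<oplus>\<^bsub>?L\<^esub> x = x" "\<one>\<^bsub>?L\<^esub> \<otimes>\<^bsub>?L\<^esub> x = x"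
      using x by (simp_all add: ops)
    have "fraction R T (\<ominus> a) s \<oplus>\<^bsub>?L\<^esub> x = \<zero>\<^bsub>?L\<^esub>"
      unfolding x(1) using x(2,3) by (simp add: ops r_minus l_neg) (rule eq; simp add: T_carrier)
    moreover have "fraction R T (\<ominus> a) s \<in> carrier ?L"
      using x(2,3) by (simp add: closed)
    ultimately show "\<exists>y\<in>carrier ?L. y \<oplus>\<^bsub>?L\<^esub> x = \<zero>\<^bsub>?L\<^esub>"
      by blast
  next
    fix x y assume "x \<in> carrier ?L" "y \<in> carrier ?L"
    then obtain a s b t where x: "x = fraction R T a s" "a \<in> carrier R" "s \<in> T"
      and y: "y = fraction R T b t" "b \<in> carrier R" "t \<in> T"
      by (metis rep)
    show "x \<oplus>\<^bsub>?L\<^esub> y \<in> carrier ?L" "x \<otimes>\<^bsub>?L\<^esub> y \<in> carrier ?L"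
      unfolding x(1) y(1) using x(2,3) y(2,3) by (simp_all add: ops closed)
    show "x \<oplus>\<^bsub>?L\<^esub> y = y \<oplus>\<^bsub>?L\<^esub> x" "x \<otimes>\<^bsub>?L\<^esub> y = y \<otimes>\<^bsub>?L\<^esub> x"
      unfolding x(1) y(1) using x(2,3) y(2,3) by (simp_all add: ops m_comm a_comm)
  next
    fix x y z assume "x \<in> carrier ?L" "y \<in> carrier ?L" "z \<in> carrier ?L"
    then obtain a s b t c w where x: "x = fraction R T a s" "a \<in> carrier R" "s \<in> T"
      and y: "y = fraction R T b t" "b \<in> carrier R" "t \<in> T"
      and z: "z = fraction R T c w" "c \<in> carrier R" "w \<in> T"
      by (metis rep)
    note car = x(2,3) y(2,3) z(2,3)
    show "x \<oplus>\<^bsub>?L\<^esub> y \<oplus>\<^bsub>?L\<^esub> z = x \<oplus>\<^bsub>?L\<^esub> (y \<oplus>\<^bsub>?L\<^esub> z)"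
      "x \<otimes>\<^bsub>?L\<^esub> y \<otimes>\<^bsub>?L\<^esub> z = x \<otimes>\<^bsub>?L\<^esub> (y \<otimes>\<^bsub>?L\<^esub> z)"
      unfolding x(1) y(1) z(1) using car by (simp_all add: ops r_distr m_ac a_ac)
    show "(x \<oplus>\<^bsub>?L\<^esub> y) \<otimes>\<^bsub>?L\<^esub> z = x \<otimes>\<^bsub>?L\<^esub> z \<oplus>\<^bsub>?L\<^esub> y \<otimes>\<^bsub>?L\<^esub> z"
      unfolding x(1) y(1) z(1) using car by (simp add: ops) (rule eq; simp add: T_carrier r_distr m_ac)
  qed
qed

end

end

theory Submission
  imports Defs
begin

text \<open>The map \<open>a \<mapsto> a/1\<close> has kernel \<open>{a. \<exists>u\<in>T. u a = 0}\<close>. In a local ring every element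
  outside the maximal ideal is a unit, so a member of \<open>T\<close> is invertible at cofinitely many
  indices; conversely \<open>T\<close> contains the idempotent \<open>e\<^sub>A\<close> of every cofinite \<open>A\<close>. Hence the kernel
  is the direct sum ideal. The map is onto: inverting \<open>s \<in> T\<close> on \<open>A = \<Omega>(s)\<close> gives \<open>t\<close> with
  \<open>e\<^sub>A s t = e\<^sub>A\<close>, so \<open>a/s = t a/1\<close>.\<close>

section \<open>Units in a local ring\<close>

text \<open>Zorn's lemma applied to the ideals above \<open>J\<close> that avoid
  \<open>\<one>\<close>. Supplies the maximal ideal that uniqueness in a local ring then
  identifies.\<close>

lemma (in cring) ideal_le_maximalideal:
  assumes J: "ideal J R" "\<one> \<notin> J"
  shows "\<exists>M. maximalideal M R \<and> J \<subseteq> M"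
proof -
  \<comment> \<open>Properness is phrased as \<open>\<one> \<notin> K\<close> because this form
    passes at once to unions of chains.\<close>
  define A where "A = {K. ideal K R \<and> J \<subseteq> K \<and> \<one> \<notin> K}"
  have "\<exists>M\<in>A. \<forall>Y\<in>A. M \<subseteq> Y \<longrightarrow> Y = M"
  proof (rule subset_Zorn)
    fix C assume C: "subset.chain A C"
    show "\<exists>U\<in>A. \<forall>Y\<in>C. Y \<subseteq> U"
    proof (cases "C = {}")
      \<comment> \<open>The empty union is no ideal, so the empty chain gets \<open>J\<close> itself
        as upper bound.\<close>
      case True
      then show ?thesis using J by (auto simp: A_def)
    next
      case False
      have "subset.chain {I. ideal I R} C"
        using C by (auto simp: pred_on.chain_def A_def)
      from chain_Union_is_ideal[OF this] False have "ideal (\<Union>C) R" by simp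
      moreover have "C \<subseteq> A"
        using C by (auto simp: pred_on.chain_def)
      ultimately have "\<Union>C \<in> A"
        using False by (auto simp: A_def)
      then show ?thesis by blast
    qed
  qed
  then obtain M where M: "M \<in> A" "\<And>Y. Y \<in> A \<Longrightarrow> M \<subseteq> Y \<Longrightarrow> Y = M" by blast
  have "maximalideal M R"
  proof (rule maximalidealI)
    show "ideal M R" "carrier R \<noteq> M"
      using M(1) by (auto simp: A_def)
  next
    fix K assume K: "ideal K R" "M \<subseteq> K" "K \<subseteq> carrier R"
    show "K = M \<or> K = carrier R"
    proof (cases "\<one> \<in> K")
      case True
      then show ?thesis using ideal.one_imp_carrier[OF K(1)] by simp
    next
      case False
      then have "K \<in> A" using K M(1) by (auto simp: A_def)
      then show ?thesis using M(2) K(2) by blast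
    qed
  qed
  then show ?thesis using M(1) by (auto simp: A_def)
qed

text \<open>Without an inverse, \<open>PIdl x\<close> is proper and lies in some maximal ideal; by
  uniqueness that is \<open>M\<close>, which would then contain \<open>x\<close>.\<close>

lemma (in local_cring) left_inverse_if_notin_maximalideal:
  assumes "maximalideal M R" "x \<in> carrier R" "x \<notin> M"
  shows "\<exists>y\<in>carrier R. y \<otimes> x = \<one>"
proof (rule ccontr)
  assume "\<not> ?thesis"
  then have "\<one> \<notin> PIdl x" by (auto simp: cgenideal_def)
  then obtain N where "maximalideal N R" "PIdl x \<subseteq> N"
    using ideal_le_maximalideal[OF cgenideal_ideal] assms(2) by blast
  then show False
    using unique_maximalideal assms cgenideal_self[OF assms(2)] by blast
qed

section \<open>The canonical map into a localization\<close>

context cring_mult_subset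
begin

lemma fraction_one_ring_hom: "ring_hom_ring R (localization R T) (\<lambda>a. fraction R T a \<one>)"
proof (rule ring_hom_ringI)
  show "ring (localization R T)"
    using cring_localization by (rule cring.axioms)
next
  show "fraction R T a \<one> \<in> carrier (localization R T)" if "a \<in> carrier R" for a
    using that submonoid.one_closed[OF submonoid_axioms] unfolding localization_carrier by blast
qed (simp_all add: localization_mult localization_add localization_one ring_axioms)

lemma fraction_one_kernel:
  "a_kernel R (localization R T) (\<lambda>a. fraction R T a \<one>) = {a \<in> carrier R. \<exists>u\<in>T. u \<otimes> a = \<zero>}"
proof -
  have "fraction R T a \<one> = fraction R T \<zero> \<one> \<longleftrightarrow> (\<exists>u\<in>T. u \<otimes> a = \<zero>)" if "a \<in> carrier R" for a
    using that by (subst fraction_eq_iff) (simp_all add: T_carrier)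
  then show ?thesis
    by (auto simp: a_kernel_def' localization_zero)
qed

text \<open>An inverse of \<open>s\<close> is needed only up to a factor \<open>u \<in> T\<close>:
  that same \<open>u\<close> witnesses the equality of \<open>a/s\<close> and
  \<open>(t \<otimes> a)/1\<close>.\<close>

lemma fraction_one_surj:
  assumes inv: "\<And>s. s \<in> T \<Longrightarrow> \<exists>t\<in>carrier R. \<exists>u\<in>T. u \<otimes> (t \<otimes> s) = u"
  shows "(\<lambda>a. fraction R T a \<one>) ` carrier R = carrier (localization R T)"
proof (intro equalityI subsetI)
  fix x assume "x \<in> carrier (localization R T)"
  then obtain a s where x: "x = fraction R T a s" and a: "a \<in> carrier R" and s: "s \<in> T"
    by (auto simp: localization_carrier)
  obtain t u where t: "t \<in> carrier R" and u: "u \<in> T" and eq: "u \<otimes> (t \<otimes> s) = u"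
    using inv[OF s] by blast
  note car = a t T_carrier[OF s] T_carrier[OF u]
  have "u \<otimes> (s \<otimes> (t \<otimes> a)) = u \<otimes> (t \<otimes> s) \<otimes> a"
    using car by (simp add: m_ac)
  also have "\<dots> = u \<otimes> (\<one> \<otimes> a)"
    using car by (simp only: eq l_one)
  finally have "u \<otimes> (s \<otimes> (t \<otimes> a)) = u \<otimes> (\<one> \<otimes> a)" .
  then have "fraction R T (t \<otimes> a) \<one> = x"
    unfolding x using car s u by (subst fraction_eq_iff) auto
  then show "x \<in> (\<lambda>a. fraction R T a \<one>) ` carrier R"
    using a t by blast
next
  fix x assume "x \<in> (\<lambda>a. fraction R T a \<one>) ` carrier R"
  then show "x \<in> carrier (localization R T)"
    using ring_hom_closed[OF ring_hom_ring.homh[OF fraction_one_ring_hom]] by auto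
qed

end

section \<open>Products of local rings\<close>

locale local_cring_family =
  fixes S :: "'k set" and R :: "'k \<Rightarrow> ('a, 'c) ring_scheme" and \<mm> :: "'k \<Rightarrow> 'a set"
  assumes local: "k \<in> S \<Longrightarrow> local_cring (R k)"
    and maximal: "k \<in> S \<Longrightarrow> maximalideal (\<mm> k) (R k)"
begin

definition cofinite_units :: "('k \<Rightarrow> 'a) set" where
  "cofinite_units = {r \<in> carrier (product_ring S R). cofinite_in S (Omega S \<mm> r)}"

definition idempotent :: "'k set \<Rightarrow> 'k \<Rightarrow> 'a" where
  "idempotent A = (\<lambda>k\<in>S. if k \<in> A then \<one>\<^bsub>R k\<^esub> else \<zero>\<^bsub>R k\<^esub>)"

lemma cofinite_units_iff:
  "r \<in> cofinite_units \<longleftrightarrow> r \<in> carrier (product_ring S R) \<and> finite (S - Omega S \<mm> r)"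
  by (auto simp: cofinite_units_def cofinite_in_def Omega_def)

lemma cring_component: "k \<in> S \<Longrightarrow> cring (R k)"
  using local by (rule local_cring.axioms)

text \<open>The selected rules are closure of zero, product and one, the left unit law, and both
  annihilation laws for zero.\<close>

lemmas component_simps = cring.cring_simprules(2,5,6,12,26,27)[OF cring_component]

lemma one_notin: "k \<in> S \<Longrightarrow> \<one>\<^bsub>R k\<^esub> \<notin> \<mm> k"
  using ideal.one_imp_carrier[OF maximalideal.axioms(1)[OF maximal]] maximalideal.I_notcarr[OF maximal]
  by blast

lemma Omega_one: "Omega S \<mm> \<one>\<^bsub>product_ring S R\<^esub> = S"
  by (auto simp: Omega_def product_ring_simps one_notin)

text \<open>Maximal ideals are prime, so a product of two elements outside \<open>\<mm> k\<close>
  stays outside. This inclusion bounds the complement for the product by a union of two finite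
  sets.\<close>

lemma Omega_mult:
  assumes "x \<in> carrier (product_ring S R)" "y \<in> carrier (product_ring S R)"
  shows "Omega S \<mm> x \<inter> Omega S \<mm> y \<subseteq> Omega S \<mm> (x \<otimes>\<^bsub>product_ring S R\<^esub> y)"
  using assms primeideal.I_prime[OF cring.maximalideal_prime[OF cring_component maximal]]
  by (fastforce simp: Omega_def product_ring_simps PiE_iff)

lemma submonoid_cofinite_units: "submonoid cofinite_units (product_ring S R)"
proof
  interpret P: cring "product_ring S R"
    using cring_component by (rule cring_product_ring)
  show "\<one>\<^bsub>product_ring S R\<^esub> \<in> cofinite_units"
    by (simp add: cofinite_units_iff Omega_one)
  fix x y assume xy: "x \<in> cofinite_units" "y \<in> cofinite_units"
  then have car: "x \<in> carrier (product_ring S R)" "y \<in> carrier (product_ring S R)"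
    by (auto simp: cofinite_units_iff)
  have "S - Omega S \<mm> (x \<otimes>\<^bsub>product_ring S R\<^esub> y) \<subseteq> (S - Omega S \<mm> x) \<union> (S - Omega S \<mm> y)"
    using Omega_mult[OF car] by blast
  then have "finite (S - Omega S \<mm> (x \<otimes>\<^bsub>product_ring S R\<^esub> y))"
    by (rule finite_subset) (use xy in \<open>simp add: cofinite_units_iff\<close>)
  then show "x \<otimes>\<^bsub>product_ring S R\<^esub> y \<in> cofinite_units"
    using P.m_closed[OF car] by (simp add: cofinite_units_iff)
qed (auto simp: cofinite_units_iff)

lemma idempotent_in_cofinite_units:
  assumes "cofinite_in S A"
  shows "idempotent A \<in> cofinite_units"
proof -
  have "idempotent A \<in> carrier (product_ring S R)"
    by (simp add: product_ring_simps idempotent_def component_simps)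
  moreover have "S - Omega S \<mm> (idempotent A) \<subseteq> S - A"
    by (auto simp: Omega_def idempotent_def one_notin)
  then have "finite (S - Omega S \<mm> (idempotent A))"
    by (rule finite_subset) (use assms in \<open>simp add: cofinite_in_def\<close>)
  ultimately show ?thesis
    by (simp add: cofinite_units_iff)
qed

text \<open>Inverses are chosen index by index and assembled into one element of the
  product.\<close>

lemma left_inverse:
  assumes "s \<in> carrier (product_ring S R)"
  shows "\<exists>t\<in>carrier (product_ring S R). \<forall>k\<in>Omega S \<mm> s. t k \<otimes>\<^bsub>R k\<^esub> s k = \<one>\<^bsub>R k\<^esub>"
proof -
  \<comment> \<open>The implication sits under the quantifier so that the choice also yields a
    carrier element where \<open>s k\<close> lies in \<open>\<mm> k\<close>; zero serves
    there.\<close>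
  have "\<exists>y\<in>carrier (R k). k \<in> Omega S \<mm> s \<longrightarrow> y \<otimes>\<^bsub>R k\<^esub> s k = \<one>\<^bsub>R k\<^esub>" if "k \<in> S" for k
    using local_cring.left_inverse_if_notin_maximalideal[OF local[OF that] maximal[OF that], of "s k"]
      assms that component_simps[OF that]
    by (auto simp: Omega_def product_ring_simps PiE_iff)
  then obtain f where "\<And>k. k \<in> S \<Longrightarrow> f k \<in> carrier (R k)"
    and "\<And>k. k \<in> S \<Longrightarrow> k \<in> Omega S \<mm> s \<Longrightarrow> f k \<otimes>\<^bsub>R k\<^esub> s k = \<one>\<^bsub>R k\<^esub>"
    by metis
  then show ?thesis
    by (intro bexI[of _ "restrict f S"]) (auto simp: product_ring_simps Omega_def)
qed

sublocale cring_mult_subset "product_ring S R" cofinite_units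
  using cring_product_ring[OF cring_component] submonoid_cofinite_units by (rule cring_mult_subset.intro)

lemma cofinite_units_left_inverse:
  assumes s: "s \<in> cofinite_units"
  shows "\<exists>t\<in>carrier (product_ring S R). \<exists>u\<in>cofinite_units.
    u \<otimes>\<^bsub>product_ring S R\<^esub> (t \<otimes>\<^bsub>product_ring S R\<^esub> s) = u"
proof -
  obtain t where t: "t \<in> carrier (product_ring S R)"
    and inv: "\<And>k. k \<in> Omega S \<mm> s \<Longrightarrow> t k \<otimes>\<^bsub>R k\<^esub> s k = \<one>\<^bsub>R k\<^esub>"
    using left_inverse[OF T_carrier[OF s]] by blast
  have u: "idempotent (Omega S \<mm> s) \<in> cofinite_units"
    using s by (intro idempotent_in_cofinite_units) (simp only: cofinite_units_def mem_Collect_eq)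
  \<comment> \<open>On \<open>Omega S \<mm> s\<close> the factor \<open>t k \<otimes> s k\<close> is
    one; at all other indices both sides are zero.\<close>
  have "idempotent (Omega S \<mm> s) \<otimes>\<^bsub>product_ring S R\<^esub> (t \<otimes>\<^bsub>product_ring S R\<^esub> s)
    = idempotent (Omega S \<mm> s)"
    using t T_carrier[OF s]
    by (auto simp: product_ring_simps idempotent_def PiE_iff inv component_simps intro!: restrict_ext)
  then show ?thesis using t u by blast
qed

text \<open>If \<open>u\<close> kills \<open>a\<close>, then \<open>a\<close> vanishes wherever
  \<open>u\<close> is invertible, hence at cofinitely many indices. Conversely, \<open>a\<close> is
  killed by the idempotent supported on its own zero set.\<close>

lemma annihilated_eq_direct_sum_ideal:
  "{a \<in> carrier (product_ring S R).
      \<exists>u\<in>cofinite_units. u \<otimes>\<^bsub>product_ring S R\<^esub> a = \<zero>\<^bsub>product_ring S R\<^esub>}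
    = direct_sum_ideal S R" (is "?N = _")
proof (intro equalityI subsetI)
  fix a assume "a \<in> ?N"
  then obtain u where a: "a \<in> carrier (product_ring S R)" and u: "u \<in> cofinite_units"
    and ua: "u \<otimes>\<^bsub>product_ring S R\<^esub> a = \<zero>\<^bsub>product_ring S R\<^esub>" by blast
  obtain t where t: "t \<in> carrier (product_ring S R)"
    and inv: "\<And>k. k \<in> Omega S \<mm> u \<Longrightarrow> t k \<otimes>\<^bsub>R k\<^esub> u k = \<one>\<^bsub>R k\<^esub>"
    using left_inverse[OF T_carrier[OF u]] by blast
  have "a k = \<zero>\<^bsub>R k\<^esub>" if k: "k \<in> Omega S \<mm> u" for k
  proof -
    have kS: "k \<in> S" using k by (simp add: Omega_def)
    have car: "a k \<in> carrier (R k)" "t k \<in> carrier (R k)" "u k \<in> carrier (R k)"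
      using a t T_carrier[OF u] kS by (auto simp: product_ring_simps)
    have "u k \<otimes>\<^bsub>R k\<^esub> a k = \<zero>\<^bsub>R k\<^esub>"
      using fun_cong[OF ua, of k] kS by (simp add: product_ring_simps)
    \<comment> \<open>Multiplying by \<open>t k\<close> and reassociating prepares the cancellation
      of \<open>u k\<close>.\<close>
    then have "t k \<otimes>\<^bsub>R k\<^esub> u k \<otimes>\<^bsub>R k\<^esub> a k = \<zero>\<^bsub>R k\<^esub>"
      using car kS by (simp add: cring.cring_simprules(11)[OF cring_component] component_simps)
    then show ?thesis
      using car kS by (simp add: inv[OF k] component_simps)
  qed
  then have "{k \<in> S. a k \<noteq> \<zero>\<^bsub>R k\<^esub>} \<subseteq> S - Omega S \<mm> u" by blast
  then have "finite {k \<in> S. a k \<noteq> \<zero>\<^bsub>R k\<^esub>}"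
    by (rule finite_subset) (use u cofinite_units_iff in blast)
  then show "a \<in> direct_sum_ideal S R"
    using a by (simp add: direct_sum_ideal_def)
next
  fix a assume a: "a \<in> direct_sum_ideal S R"
  define A where "A = {k \<in> S. a k = \<zero>\<^bsub>R k\<^esub>}"
  have "S - A = {k \<in> S. a k \<noteq> \<zero>\<^bsub>R k\<^esub>}" by (auto simp: A_def)
  then have "idempotent A \<in> cofinite_units"
    using a by (intro idempotent_in_cofinite_units) (auto simp: direct_sum_ideal_def cofinite_in_def A_def)
  moreover have "idempotent A \<otimes>\<^bsub>product_ring S R\<^esub> a = \<zero>\<^bsub>product_ring S R\<^esub>"
    using a by (auto simp: direct_sum_ideal_def product_ring_simps idempotent_def A_def PiE_iff
        component_simps intro!: restrict_ext)
  ultimately show "a \<in> ?N"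
    using a by (auto simp: direct_sum_ideal_def)
qed

end

theorem theorem2p22:
  fixes S :: "'k set"
    and R :: "'k \<Rightarrow> ('a, 'c) ring_scheme"
    and \<mm> :: "'k \<Rightarrow> 'a set"
    and P :: "('k \<Rightarrow> 'a) ring"
    and I T :: "('k \<Rightarrow> 'a) set"
  assumes "\<And>k. k \<in> S \<Longrightarrow> local_cring (R k)"
    and "\<And>k. k \<in> S \<Longrightarrow> maximalideal (\<mm> k) (R k)"
    and "P = product_ring S R"
    and "I = direct_sum_ideal S R"
    and "T = {r \<in> carrier P. cofinite_in S (Omega S \<mm> r)}"
  shows "ideal I P \<and> submonoid T P \<and>
    (\<forall>a\<in>carrier P. \<forall>b\<in>carrier P. I +>\<^bsub>P\<^esub> a = I +>\<^bsub>P\<^esub> b \<longrightarrow> fraction P T a \<one>\<^bsub>P\<^esub> = fraction P T b \<one>\<^bsub>P\<^esub>) \<and>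
    (\<exists>\<phi>. \<phi> \<in> ring_iso (P Quot I) (localization P T) \<and>
      (\<forall>a\<in>carrier P. \<phi> (I +>\<^bsub>P\<^esub> a) = fraction P T a \<one>\<^bsub>P\<^esub>))"
proof -
  interpret local_cring_family S R \<mm>
    using assms(1,2) by (rule local_cring_family.intro)
  have T: "T = cofinite_units"
    unfolding assms(3,5) cofinite_units_def ..
  let ?h = "\<lambda>a. fraction P T a \<one>\<^bsub>P\<^esub>"
  interpret h: ring_hom_ring P "localization P T" ?h
    unfolding assms(3) T by (rule fraction_one_ring_hom)
  have I: "a_kernel P (localization P T) ?h = I"
    unfolding assms(3,4) T fraction_one_kernel annihilated_eq_direct_sum_ideal ..
  have surj: "?h ` carrier P = carrier (localization P T)"
    unfolding assms(3) T using cofinite_units_left_inverse by (rule fraction_one_surj)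
  \<comment> \<open>The first isomorphism theorem in explicit form: \<open>?h\<close> is constant on
    each coset of its kernel, so the image of a coset is a singleton and \<open>the_elem\<close>
    extracts its value.\<close>
  define \<phi> where "\<phi> = (\<lambda>Y. the_elem (?h ` Y))"
  have iso: "\<phi> \<in> ring_iso (P Quot I) (localization P T)"
    using h.FactRing_iso_set[OF surj] unfolding I \<phi>_def .
  have \<phi>: "\<phi> (I +>\<^bsub>P\<^esub> a) = ?h a" if "a \<in> carrier P" for a
    using h.the_elem_simp[OF that] unfolding I \<phi>_def .
  have "ideal I P"
    using h.kernel_is_ideal unfolding I .
  moreover have "submonoid T P"
    unfolding assms(3) T by (rule submonoid_cofinite_units)
  \<comment> \<open>Well-definedness is read off from \<open>\<phi>\<close>, whose value depends
    only on the coset.\<close>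
  moreover have "?h a = ?h b" if "a \<in> carrier P" "b \<in> carrier P" "I +>\<^bsub>P\<^esub> a = I +>\<^bsub>P\<^esub> b" for a b
    using \<phi>[OF that(1)] \<phi>[OF that(2)] that(3) by simp
  ultimately show ?thesis
    using iso \<phi> by blast
qed

end
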